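(* Let $\sigma:\mathbb{R}^n\to\mathbb{R}^{n\times m}$ be of class $C^2$ and let $u:\mathbb{R}^n\to\mathbb{R}$ be of class $C^3$. Let $\bar x\in\mathbb{R}^n$ be a point such that $\nabla u(\bar x)\ne0$ and $\nabla u(\bar x)\,\sigma(\bar x)=0$, and suppose that $K(\bar x)$ has a negative eigenvalue. Then the target $\mathcal T=\{x:u(x)\le u(\bar x)\}$ is STLA at $\bar x$ for the symmetric system $\dot x_t=\sigma(x_t)a_t$, with controls valued in $B_1(0)=\{a\in\mathbb{R}^m:|a|\le1\}$, and there are $C,r>0$ such that the minimum time function satisfies $T(x)\le C|x-\bar x|^{1/2}$ whenever $|x-\bar x|\le r$. Moreover, the coordinates of an eigenvector $(a_1,a_2)\in\mathbb{R}^m\times\mathbb{R}^m$ of $K(\bar x)$ with minimal eigenvalue, scaled so that $|a_1|,|a_2|\le1$, provide controls for reaching the target in finite time: for every $x_0$ sufficiently close to $\bar x$ there is $t>0$ such that the trajectory starting at $x_0$ with control equal to $a_1$ on $[0,t)$ and to $a_2$ on $[t,2t]$ reaches $\mathcal T$ within time $2t$.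
   Context: Controls $a_\cdot:[0,+\infty)\to B_1(0)$ are piecewise constant (finitely many pieces on bounded intervals); trajectories are solutions of the system on their maximal interval of existence. Minimum time function: $T(x)=\inf_{a_\cdot}t_x(a_\cdot)$, $t_x(a_\cdot)=\inf\{t\ge0:x_t\in\mathcal T\}$ with $x_0=x$ ($\inf\emptyset=+\infty$). $\mathcal T$ is small time locally attainable (STLA) at $\bar x$ if for every $t>0$ the point $\bar x$ is interior to the set of points from which $\mathcal T$ can be reached in time less than $t$ along trajectories of the system (equivalently, $T$ is continuous at $\bar x$). Here $\nabla u\,\sigma$ is the vector function with components $\nabla u\cdot\sigma_i$, $i=1,\dots,m$, with $\sigma_i$ the columns of $\sigma$. Define the $m\times m$ matrix $S(x)=D(\nabla u\,\sigma)(x)\,\sigma(x)$, that is $S_{i,j}(x)=\nabla(\nabla u\cdot\sigma_i)(x)\cdot\sigma_j(x)$; let $S^*=\frac12(S+{}^tS)$. Define the symmetric $2m\times2m$ matrix $$K(x)=\begin{pmatrix}S^*(x)&{}^tS(x)\\S(x)&S^*(x)\end{pmatrix}.$$ *)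

theory Defs
  imports "HOL-Analysis.Analysis"
begin

section \<open>Functions of class \<open>C\<^sup>k\<close>\<close>

text \<open>In finite dimension, \<open>f\<close> is of class \<open>C\<^sup>k\<^sup>+\<^sup>1\<close> iff it is differentiable and all its
  directional derivatives are of class \<open>C\<^sup>k\<close>.\<close>

primrec class_C :: "nat \<Rightarrow> ('a::euclidean_space \<Rightarrow> 'b::euclidean_space) \<Rightarrow> bool" where
  "class_C 0 f \<longleftrightarrow> continuous_on UNIV f"
| "class_C (Suc k) f \<longleftrightarrow>
     (\<forall>x. f differentiable at x) \<and> (\<forall>v. class_C k (\<lambda>x. frechet_derivative f (at x) v))"

section \<open>The matrices \<open>S\<close> and \<open>K\<close>\<close>

definition grad :: "('a::real_inner \<Rightarrow> real) \<Rightarrow> 'a \<Rightarrow> 'a" where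
  "grad u x = (THE D. GDERIV u x :> D)"

definition grad_along :: "(real^'n \<Rightarrow> real) \<Rightarrow> (real^'n \<Rightarrow> real^'m^'n) \<Rightarrow> real^'n \<Rightarrow> real^'m" where
  "grad_along u \<sigma> x = (\<chi> i. grad u x \<bullet> column i (\<sigma> x))"

definition S_mat :: "(real^'n \<Rightarrow> real) \<Rightarrow> (real^'n \<Rightarrow> real^'m^'n) \<Rightarrow> real^'n \<Rightarrow> real^'m^'m" where
  "S_mat u \<sigma> x = jacobian (grad_along u \<sigma>) (at x) ** \<sigma> x"

definition sym_part :: "real^'m^'m \<Rightarrow> real^'m^'m" where
  "sym_part A = (1/2) *\<^sub>R (A + transpose A)"

definition block_mat ::
  "real^'m^'m \<Rightarrow> real^'m^'m \<Rightarrow> real^'m^'m \<Rightarrow> real^'m^'m \<Rightarrow> real^('m + 'm)^('m + 'm)" where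
  "block_mat A B C D = (\<chi> p q. case (p, q) of
      (Inl i, Inl j) \<Rightarrow> A $ i $ j | (Inl i, Inr j) \<Rightarrow> B $ i $ j
    | (Inr i, Inl j) \<Rightarrow> C $ i $ j | (Inr i, Inr j) \<Rightarrow> D $ i $ j)"

definition K_mat ::
  "(real^'n \<Rightarrow> real) \<Rightarrow> (real^'n \<Rightarrow> real^'m^'n) \<Rightarrow> real^'n \<Rightarrow> real^('m + 'm)^('m + 'm)" where
  "K_mat u \<sigma> x = (let S = S_mat u \<sigma> x in
     block_mat (sym_part S) (transpose S)
               S            (sym_part S))"

definition vec_join :: "real^'m \<Rightarrow> real^'m \<Rightarrow> real^('m + 'm)" where
  "vec_join a b = (\<chi> p. case p of Inl i \<Rightarrow> a $ i | Inr i \<Rightarrow> b $ i)"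

definition eigenvector_of :: "real^'k^'k \<Rightarrow> real \<Rightarrow> real^'k \<Rightarrow> bool" where
  "eigenvector_of A l v \<longleftrightarrow> v \<noteq> 0 \<and> A *v v = l *\<^sub>R v"

definition eigenvalue_of :: "real^'k^'k \<Rightarrow> real \<Rightarrow> bool" where
  "eigenvalue_of A l \<longleftrightarrow> (\<exists>v. eigenvector_of A l v)"

definition minimal_eigenvalue :: "real^'k^'k \<Rightarrow> real \<Rightarrow> bool" where
  "minimal_eigenvalue A l \<longleftrightarrow> eigenvalue_of A l \<and> (\<forall>l'. eigenvalue_of A l' \<longrightarrow> l \<le> l')"

text \<open>The componentwise form of \<open>S\<close>.\<close>

lemma grad_eqI:
  assumes "GDERIV u x :> D"
  shows "grad u x = D"
  unfolding grad_def
proof (rule the_equality[where P = "\<lambda>D. GDERIV u x :> D", OF assms])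
  fix E assume "GDERIV u x :> E"
  then have "(\<bullet>) E = (\<bullet>) D"
    using assms has_derivative_unique unfolding gderiv_def
    by (metis (no_types, lifting) ext inner_commute)
  then show "E = D"
    by (metis inner_eq_zero_iff inner_diff_left diff_self eq_iff_diff_eq_0)
qed

lemma S_mat_component:
  fixes u :: "real^'n \<Rightarrow> real" and \<sigma> :: "real^'n \<Rightarrow> real^'m^'n"
  assumes "grad_along u \<sigma> differentiable at x"
  shows "S_mat u \<sigma> x $ i $ j =
    grad (\<lambda>y. grad u y \<bullet> column i (\<sigma> y)) x \<bullet> column j (\<sigma> x)"
proof -
  let ?J = "jacobian (grad_along u \<sigma>) (at x)"
  have "(grad_along u \<sigma> has_derivative (\<lambda>h. ?J *v h)) (at x)"
    using assms by (simp add: jacobian_works)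
  then have "((\<lambda>y. grad_along u \<sigma> y $ i) has_derivative (\<lambda>h. (?J *v h) $ i)) (at x)"
    by (rule bounded_linear.has_derivative[OF bounded_linear_vec_nth])
  moreover have "(?J *v h) $ i = h \<bullet> (?J $ i)" for h
    by (simp add: matrix_vector_mul_component inner_commute)
  ultimately have "GDERIV (\<lambda>y. grad u y \<bullet> column i (\<sigma> y)) x :> ?J $ i"
    by (simp add: gderiv_def grad_along_def)
  then have "grad (\<lambda>y. grad u y \<bullet> column i (\<sigma> y)) x = ?J $ i"
    by (rule grad_eqI)
  then show ?thesis
    by (simp add: S_mat_def matrix_matrix_mult_def inner_vec_def column_def)
qed

section \<open>Controls and trajectories of the symmetric system\<close>

definition piecewise_constant :: "(real \<Rightarrow> 'a) \<Rightarrow> bool" where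
  "piecewise_constant a \<longleftrightarrow> (\<forall>b. \<exists>\<J>. finite \<J> \<and> \<Union>\<J> = {0..b} \<and>
     (\<forall>J\<in>\<J>. is_interval J \<and> a constant_on J))"

text \<open>A control is a map on \<open>[0, \<infinity>)\<close>; its values at negative times are irrelevant.\<close>

definition controls :: "(real \<Rightarrow> real^'m) set" where
  "controls = {a. piecewise_constant a \<and> (\<forall>t\<ge>0. a t \<in> cball 0 1)}"

text \<open>For a piecewise constant control the solutions are the continuous functions satisfying
  the equation at all times where the control does not jump. At the endpoints of \<open>I\<close> that
  belong to \<open>I\<close> the derivative is one-sided.\<close>

definition solution_on ::
  "(real^'n \<Rightarrow> real^'m^'n) \<Rightarrow> (real \<Rightarrow> real^'m) \<Rightarrow> real^'n \<Rightarrow> real set \<Rightarrow> (real \<Rightarrow> real^'n) \<Rightarrow> bool" where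
  "solution_on \<sigma> a x\<^sub>0 I y \<longleftrightarrow>
     is_interval I \<and> 0 \<in> I \<and> I \<subseteq> {0..} \<and> y 0 = x\<^sub>0 \<and> continuous_on I y \<and>
     (\<forall>t\<in>I. continuous (at t within {0..}) a \<longrightarrow>
        (y has_vector_derivative \<sigma> (y t) *v a t) (at t within I))"

text \<open>The trajectory starting at \<open>x\<^sub>0\<close> with control \<open>a\<close>: a solution \<open>y\<close> on its maximal
  interval of existence \<open>I\<close>.\<close>

definition trajectory ::
  "(real^'n \<Rightarrow> real^'m^'n) \<Rightarrow> (real \<Rightarrow> real^'m) \<Rightarrow> real^'n \<Rightarrow> real set \<Rightarrow> (real \<Rightarrow> real^'n) \<Rightarrow> bool" where
  "trajectory \<sigma> a x\<^sub>0 I y \<longleftrightarrow> solution_on \<sigma> a x\<^sub>0 I y \<and>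
     (\<forall>J z. solution_on \<sigma> a x\<^sub>0 J z \<and> I \<subseteq> J \<and> (\<forall>t\<in>I. z t = y t) \<longrightarrow> J = I)"

section \<open>Minimum time and small time local attainability\<close>

definition hitting_times ::
  "(real^'n \<Rightarrow> real^'m^'n) \<Rightarrow> (real^'n) set \<Rightarrow> real^'n \<Rightarrow> (real \<Rightarrow> real^'m) \<Rightarrow> real set" where
  "hitting_times \<sigma> \<T> x a = {t. \<exists>I y. trajectory \<sigma> a x I y \<and> t \<in> I \<and> y t \<in> \<T>}"

text \<open>In \<^typ>\<open>ereal\<close> the infimum of the empty set is \<open>\<infinity>\<close>.\<close>

definition hitting_time ::
  "(real^'n \<Rightarrow> real^'m^'n) \<Rightarrow> (real^'n) set \<Rightarrow> real^'n \<Rightarrow> (real \<Rightarrow> real^'m) \<Rightarrow> ereal" where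
  "hitting_time \<sigma> \<T> x a = Inf (ereal ` hitting_times \<sigma> \<T> x a)"

definition min_time ::
  "(real^'n \<Rightarrow> real^'m^'n) \<Rightarrow> (real^'n) set \<Rightarrow> real^'n \<Rightarrow> ereal" where
  "min_time \<sigma> \<T> x = (INF a\<in>controls. hitting_time \<sigma> \<T> x a)"

definition STLA ::
  "(real^'n \<Rightarrow> real^'m^'n) \<Rightarrow> (real^'n) set \<Rightarrow> real^'n \<Rightarrow> bool" where
  "STLA \<sigma> \<T> xb \<longleftrightarrow> (\<forall>t>0. xb \<in> interior
     {x. \<exists>a\<in>controls. \<exists>s\<in>hitting_times \<sigma> \<T> x a. s < t})"

end

theory Submission
  imports Defs
begin

text \<open>Write \<open>g = grad_along u \<sigma>\<close>, \<open>S = S_mat u \<sigma>\<close> and let \<open>y\<close> be the trajectory from \<open>x\<close> that uses \<open>a\<close> for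
  a time \<open>t\<close> and then \<open>b\<close> for a time \<open>t\<close>. While the control is \<open>a\<close>, the derivative of \<open>u\<close> along \<open>y\<close> is
  \<open>g \<bullet> a\<close> and that of \<open>g\<close> is \<open>S a\<close>. The change of \<open>g\<close> during the first arc, about \<open>t (S a)\<close>, is what
  the second arc pairs with \<open>b\<close>; to second order in \<open>t\<close>
  \<open>u (y (2 t)) = u x + t (g x \<bullet> (a + b)) + t\<^sup>2 / 2 ((S a) \<bullet> a + 2 (S a) \<bullet> b + (S b) \<bullet> b)\<close>,
  and the last bracket is the quadratic form of the matrix \<open>K\<close> at \<open>(a, b)\<close>. It is therefore negative
  at an eigenvector for a negative eigenvalue.

  Put \<open>d = \<bar>x - xb\<bar>\<close>. Both \<open>u x - u xb\<close> and, since \<open>g xb = 0\<close>, also \<open>g x\<close> are \<open>O(d)\<close>, so the negative term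
  \<open>- q t\<^sup>2 / 2\<close> wins as soon as \<open>t\<close> is a large enough multiple of \<open>sqrt d\<close>. This gives the exponent \<open>1/2\<close>,
  hence small time local attainability, and it works for every pair of controls of norm at most \<open>1\<close>
  at which the form is negative (lemma \<open>target_reached_near\<close>). The error in the expansion only has to
  be a small multiple of \<open>t\<^sup>2\<close>, for which the continuity of \<open>S\<close> at \<open>xb\<close> suffices
  (lemmas \<open>arc_estimates\<close> and \<open>two_arc_estimate\<close>).

  The rest is the theory of the differential equation with a control that switches once. A Picard
  iteration solves it on a short interval inside a ball around \<open>xb\<close>, a Gronwall argument shows that
  solutions are unique, and uniqueness has two consequences: the union of all solutions is the
  maximal one, and every maximal trajectory extends the short solution, so it inherits the estimate.\<close>

section \<open>Short time existence and uniqueness for Lipschitz equations\<close>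

text \<open>For \<open>L * T < 1\<close> the Picard operator is a contraction in the supremum norm, so Banach's fixed point
  theorem applies directly. The right hand side may jump in time: only the integral equation is
  solved, which is what a piecewise constant control requires.\<close>
lemma picard_short_time:
  fixes f :: "real \<Rightarrow> 'a::euclidean_space \<Rightarrow> 'a"
  assumes "0 \<le> T" "0 \<le> L" "L * T < 1"
    and lip: "\<And>s x y. s \<in> {0..T} \<Longrightarrow> norm (f s x - f s y) \<le> L * norm (x - y)"
    and int: "\<And>y. continuous_on {0..T} y \<Longrightarrow> (\<lambda>s. f s (y s)) integrable_on {0..T}"
  obtains y where "continuous_on {0..T} y"
    "\<And>s. s \<in> {0..T} \<Longrightarrow> y s = x0 + integral {0..s} (\<lambda>r. f r (y r))"
proof -
  define G where "G y s = x0 + integral {0..s} (\<lambda>r. f r (y r))" for y s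
  have contG: "continuous_on {0..T} (G y)" if "continuous_on {0..T} y" for y
    unfolding G_def
    by (intro continuous_intros indefinite_integral_continuous_1 int that)
  \<comment> \<open>The fixed point theorem needs a complete space, 
    so curves on \<open>{0..T}\<close> are extended to bounded continuous functions on the whole line
    that are constant outside the interval.\<close>
  have "\<exists>g :: real \<Rightarrow>\<^sub>C 'a. \<forall>s. g s = G y (clamp 0 T s)" for y :: "real \<Rightarrow>\<^sub>C 'a"
  proof -
    have "continuous_on (cbox 0 T) (G y)"
      using contG[of y] by simp
    then show ?thesis
      using continuous_on_cbox_bcontfunE by metis
  qed
  then obtain \<Phi> :: "(real \<Rightarrow>\<^sub>C 'a) \<Rightarrow> (real \<Rightarrow>\<^sub>C 'a)"
    where \<Phi>: "\<And>y s. \<Phi> y s = G y (clamp 0 T s)" by metis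
  have contr: "dist (\<Phi> y) (\<Phi> z) \<le> L * T * dist y z" for y z
  proof (rule dist_bound)
    fix s
    define c where "c = clamp 0 T s"
    have c: "0 \<le> c" "c \<le> T"
      using clamp_in_interval[of 0 T s] \<open>0 \<le> T\<close> by (auto simp: c_def)
    have i: "(\<lambda>r. f r (y r)) integrable_on {0..c}" for y :: "real \<Rightarrow>\<^sub>C 'a"
      using integrable_subinterval_real[OF int[of y]] c by auto
    have "((\<lambda>r. f r (y r) - f r (z r)) has_integral
        (integral {0..c} (\<lambda>r. f r (y r)) - integral {0..c} (\<lambda>r. f r (z r)))) {0..c}"
      by (intro has_integral_diff integrable_integral i)
    moreover have "norm (f r (y r) - f r (z r)) \<le> L * dist y z" if "r \<in> {0..c}" for r
    proof -
      have "norm (f r (y r) - f r (z r)) \<le> L * norm (y r - z r)"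
        using that c by (intro lip) auto
      also have "\<dots> \<le> L * dist y z"
        using dist_bounded[of y r z] \<open>0 \<le> L\<close> by (intro mult_left_mono) (auto simp: dist_norm)
      finally show ?thesis .
    qed
    ultimately have "norm (integral {0..c} (\<lambda>r. f r (y r)) - integral {0..c} (\<lambda>r. f r (z r)))
        \<le> L * dist y z * c"
      using has_integral_bound_real[of "L * dist y z" "{}" _ _ 0 c] \<open>0 \<le> L\<close> c by auto
    also have "\<dots> \<le> L * dist y z * T"
      using c \<open>0 \<le> L\<close> by (intro mult_left_mono) auto
    finally show "dist (\<Phi> y s) (\<Phi> z s) \<le> L * T * dist y z"
      by (simp add: \<Phi> G_def dist_norm c_def mult_ac)
  qed
  then obtain y where y: "\<Phi> y = y"
    using banach_fix_type[of "L * T" \<Phi>] assms by auto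
  show ?thesis
  proof
    show "y s = x0 + integral {0..s} (\<lambda>r. f r (y r))" if "s \<in> {0..T}" for s
      using \<Phi>[of y s] that by (simp add: y G_def)
  qed auto
qed

text \<open>Gronwall's argument: \<open>exp (- 2 L s) * \<bar>y s - z s\<bar>\<^sup>2\<close> is nonincreasing and vanishes at \<open>c\<close>. The equation
  is used in the open interval only, so that arcs meeting at a jump of the control can be treated
  one after the other.\<close>
lemma solutions_agree_at_endpoint:
  fixes F :: "'a::real_inner \<Rightarrow> 'a"
  assumes lip: "\<And>x y. x \<in> B \<Longrightarrow> y \<in> B \<Longrightarrow> norm (F x - F y) \<le> L * norm (x - y)"
    and y: "continuous_on {c..d} y" "\<And>s. s \<in> {c..d} \<Longrightarrow> y s \<in> B"
      "\<And>s. s \<in> {c<..<d} \<Longrightarrow> (y has_vector_derivative F (y s)) (at s)"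
    and z: "continuous_on {c..d} z" "\<And>s. s \<in> {c..d} \<Longrightarrow> z s \<in> B"
      "\<And>s. s \<in> {c<..<d} \<Longrightarrow> (z has_vector_derivative F (z s)) (at s)"
    and "y c = z c" "c \<le> d"
  shows "y d = z d"
proof -
  define w where "w s = y s - z s" for s
  define h where "h s = exp (- 2 * L * s) * (w s \<bullet> w s)" for s
  have "continuous_on {c..d} h"
    unfolding h_def w_def by (intro continuous_intros y z)
  moreover have "\<exists>v. (h has_real_derivative v) (at s) \<and> v \<le> 0" if s: "c < s" "s < d" for s
  proof -
    have "(y has_derivative (\<lambda>k. k *\<^sub>R F (y s))) (at s)"
      "(z has_derivative (\<lambda>k. k *\<^sub>R F (z s))) (at s)"
      using y(3)[of s] z(3)[of s] s by (auto simp: has_vector_derivative_def)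
    then have "(w has_derivative (\<lambda>k. k *\<^sub>R (F (y s) - F (z s)))) (at s)"
      unfolding w_def by (auto intro!: derivative_eq_intros simp: algebra_simps)
    then have ww: "((\<lambda>s. w s \<bullet> w s) has_real_derivative 2 * (w s \<bullet> (F (y s) - F (z s)))) (at s)"
      unfolding has_field_derivative_def
      by (auto intro!: derivative_eq_intros simp: inner_commute algebra_simps fun_eq_iff)
    have deriv: "(h has_real_derivative
        (exp (- 2 * L * s) * (2 * (w s \<bullet> (F (y s) - F (z s))) - 2 * L * (w s \<bullet> w s)))) (at s)"
      unfolding h_def
      by (rule derivative_eq_intros ww refl | simp add: algebra_simps)+
    have "w s \<bullet> (F (y s) - F (z s)) \<le> norm (w s) * norm (F (y s) - F (z s))"
      by (rule norm_cauchy_schwarz)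
    moreover have "\<dots> \<le> norm (w s) * (L * norm (w s))"
      using s by (intro mult_left_mono) (auto simp: w_def intro!: lip y z)
    moreover have "norm (w s) * (L * norm (w s)) = L * (w s \<bullet> w s)"
      by (simp add: dot_square_norm power2_eq_square)
    ultimately have "2 * (w s \<bullet> (F (y s) - F (z s))) - 2 * L * (w s \<bullet> w s) \<le> 0"
      by simp
    then have "exp (- 2 * L * s) * (2 * (w s \<bullet> (F (y s) - F (z s))) - 2 * L * (w s \<bullet> w s)) \<le> 0"
      by (intro mult_nonneg_nonpos) auto
    then show ?thesis using deriv by blast
  qed
  ultimately have "h d \<le> h c"
    using DERIV_nonpos_imp_decreasing_open[of c d h] \<open>c \<le> d\<close> by blast
  then have "w d \<bullet> w d \<le> 0"
    using \<open>y c = z c\<close> by (simp add: h_def w_def mult_le_0_iff)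
  then have "w d = 0"
    by (metis inner_eq_zero_iff inner_ge_zero order_antisym)
  then show ?thesis
    by (simp add: w_def)
qed

section \<open>Maximal trajectories from uniqueness\<close>

text \<open>The domains are intervals of \<open>{0..}\<close> containing \<open>0\<close>, hence nested; if the domain of the solution
  were the larger one, uniqueness would make it a proper extension of the trajectory.\<close>
lemma trajectory_contains_solution:
  assumes unique: "\<And>I J y z s. \<lbrakk>solution_on \<sigma> a x I y; solution_on \<sigma> a x J z; s \<in> I; s \<in> J\<rbrakk>
      \<Longrightarrow> y s = z s"
    and traj: "trajectory \<sigma> a x I y" and sol: "solution_on \<sigma> a x J z"
  shows "J \<subseteq> I"
proof (rule ccontr)
  assume "\<not> J \<subseteq> I"
  then obtain j where j: "j \<in> J" "j \<notin> I" by blast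
  have I: "is_interval I" "0 \<in> I" "I \<subseteq> {0..}" and J: "is_interval J" "0 \<in> J" "J \<subseteq> {0..}"
    using traj sol by (auto simp: trajectory_def solution_on_def)
  have "I \<subseteq> J"
  proof
    fix i assume "i \<in> I"
    then have "i \<le> j" "0 \<le> i"
    proof -
      show "0 \<le> i" using I(3) \<open>i \<in> I\<close> by auto
      have "0 \<le> j" using J(3) j(1) by auto
      then show "i \<le> j"
        using I(1,2) j(2) \<open>i \<in> I\<close> unfolding is_interval_1 by (metis linear)
    qed
    then show "i \<in> J"
      using J(1,2) j(1) unfolding is_interval_1 by blast
  qed
  moreover have "\<forall>t\<in>I. z t = y t"
    using unique[OF sol] traj \<open>I \<subseteq> J\<close> by (auto simp: trajectory_def)
  ultimately have "J = I"
    using traj sol \<open>I \<subseteq> J\<close> unfolding trajectory_def by blast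
  with j show False by simp
qed

text \<open>By uniqueness all solutions glue to one function on the union of their domains. It is a solution
  because near each time it coincides with a single one of them.\<close>
lemma maximal_trajectory_exists:
  assumes unique: "\<And>I J y z s. \<lbrakk>solution_on \<sigma> a x I y; solution_on \<sigma> a x J z; s \<in> I; s \<in> J\<rbrakk>
      \<Longrightarrow> y s = z s"
  shows "\<exists>I y. trajectory \<sigma> a x I y"
proof -
  define I where "I = \<Union>{J. \<exists>z. solution_on \<sigma> a x J z}"
  define y where "y t = (SOME v. \<exists>J z. solution_on \<sigma> a x J z \<and> t \<in> J \<and> z t = v)" for t
  have agree: "y t = z t" if "solution_on \<sigma> a x J z" "t \<in> J" for J z t
  proof -
    have "\<exists>J z. solution_on \<sigma> a x J z \<and> t \<in> J \<and> z t = y t"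
      unfolding y_def by (rule someI_ex) (use that in blast)
    then show ?thesis
      using unique that by metis
  qed
  have sub: "J \<subseteq> I" if "solution_on \<sigma> a x J z" for J z
    using that by (auto simp: I_def)
  have triv: "solution_on \<sigma> a x {0} (\<lambda>_. x)"
    by (auto simp: solution_on_def is_interval_1 has_vector_derivative_def
        has_derivative_within_singleton_iff bounded_linear_scaleR_left)
  have down: "s \<in> J" if "solution_on \<sigma> a x J z" "0 \<le> s" "s \<le> t" "t \<in> J" for J z s t
    using that unfolding solution_on_def is_interval_1 by blast
  have nonneg: "0 \<le> t" if "t \<in> I" for t
    using that by (auto simp: I_def solution_on_def)
  \<comment> \<open>The derivative within the union may only be read off from a solution 
    whose domain has the same neighbourhood filter at \<open>t\<close>: it must continue beyond \<open>t\<close> whenever the union does.\<close>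
  have loc: "\<exists>J z. solution_on \<sigma> a x J z \<and> t \<in> J \<and> at t within I = at t within J" if "t \<in> I" for t
  proof (cases "\<exists>s\<in>I. t < s")
    case True
    then obtain s J z where s: "t < s" "s \<in> J" "solution_on \<sigma> a x J z"
      by (auto simp: I_def)
    have "I \<inter> {..<s} = J \<inter> {..<s}"
      using down[OF s(3) nonneg _ s(2)] sub[OF s(3)] by auto
    then have "at t within I = at t within J"
      using at_within_nhd[of t "{..<s}" I J] s by auto
    moreover have "t \<in> J"
      using down[OF s(3) nonneg _ s(2)] \<open>t \<in> I\<close> s(1) by simp
    ultimately show ?thesis using s by blast
  next
    case False
    obtain J z where J: "t \<in> J" "solution_on \<sigma> a x J z"
      using \<open>t \<in> I\<close> by (auto simp: I_def)
    have "I = J"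
      using False sub[OF J(2)] down[OF J(2) nonneg _ J(1)] by (auto simp: not_less)
    then show ?thesis using J by blast
  qed
  have "solution_on \<sigma> a x I y"
    unfolding solution_on_def
  proof (intro conjI ballI impI)
    show "is_interval I"
      unfolding is_interval_1
    proof (intro ballI allI impI)
      fix p q r assume "p \<in> I" "q \<in> I" "p \<le> r \<and> r \<le> q"
      moreover from \<open>q \<in> I\<close> obtain J z where "solution_on \<sigma> a x J z" "q \<in> J"
        by (auto simp: I_def)
      moreover have "0 \<le> r" "r \<le> q"
        using nonneg[OF \<open>p \<in> I\<close>] \<open>p \<le> r \<and> r \<le> q\<close> by auto
      ultimately show "r \<in> I" using down sub by blast
    qed
    show "0 \<in> I" "y 0 = x" 
      using sub[OF triv] agree[OF triv] by auto
    show "I \<subseteq> {0..}"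
      by (auto simp: I_def solution_on_def)
    show "continuous_on I y"
      unfolding continuous_on_def
    proof
      fix t assume "t \<in> I"
      then obtain J z where J: "solution_on \<sigma> a x J z" "t \<in> J" "at t within I = at t within J"
        using loc by blast
      then have "(z \<longlongrightarrow> z t) (at t within J)"
        by (auto simp: solution_on_def continuous_on_def)
      moreover have "eventually (\<lambda>s. z s = y s) (at t within J)"
        using agree[OF J(1)] by (auto simp: eventually_at_filter)
      ultimately show "(y \<longlongrightarrow> y t) (at t within I)"
        using J agree by (metis (mono_tags, lifting) tendsto_cong)
    qed
    fix t assume "t \<in> I" "continuous (at t within {0..}) a"
    then obtain J z where J: "solution_on \<sigma> a x J z" "t \<in> J" "at t within I = at t within J"
      using loc by blast
    then have "(z has_vector_derivative \<sigma> (z t) *v a t) (at t within J)"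
      using \<open>continuous _ a\<close> by (auto simp: solution_on_def)
    then have "(y has_vector_derivative \<sigma> (z t) *v a t) (at t within J)"
      using J agree[OF J(1)] by (metis (no_types, lifting) has_vector_derivative_transform)
    then show "(y has_vector_derivative \<sigma> (y t) *v a t) (at t within I)"
      using J agree[OF J(1)] by simp
  qed
  then have "trajectory \<sigma> a x I y"
    using sub by (fastforce simp: trajectory_def)
  then show ?thesis by blast
qed

section \<open>Controls that switch once\<close>

abbreviation switch :: "real \<Rightarrow> 'a \<Rightarrow> 'a \<Rightarrow> real \<Rightarrow> 'a" where
  "switch t a b \<equiv> (\<lambda>s. if s < t then a else b)"

lemma switch_in_controls:
  assumes "norm a \<le> 1" "norm b \<le> 1"
  shows "switch t a b \<in> controls"
proof -
  have "\<exists>\<J>. finite \<J> \<and> \<Union>\<J> = {0..c} \<and>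
      (\<forall>J\<in>\<J>. is_interval J \<and> switch t a b constant_on J)" for c
    by (rule exI[of _ "{{0..c} \<inter> {..<t}, {0..c} \<inter> {t..}}"])
      (auto simp: is_interval_1 constant_on_def)
  then show ?thesis
    using assms by (auto simp: controls_def piecewise_constant_def)
qed

lemma continuous_switch:
  fixes a b :: "'a::topological_space"
  assumes "s \<noteq> t"
  shows "continuous (at s within A) (switch t a b)"
proof -
  have "eventually (\<lambda>r. switch t a b r = switch t a b s) (at s within A)"
  proof (cases "s < t")
    case True
    then have "eventually (\<lambda>r. r < t) (at s within A)"
      by (intro order_tendstoD(2)[OF tendsto_ident_at])
    then show ?thesis by eventually_elim (use True in simp)
  next
    case False
    then have "eventually (\<lambda>r. t < r) (at s within A)"
      using assms by (intro order_tendstoD(1)[OF tendsto_ident_at]) simp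
    then show ?thesis by eventually_elim (use False in simp)
  qed
  then show ?thesis
    unfolding continuous_within by (rule tendsto_eventually)
qed

lemma solution_on_switch_derivative:
  fixes \<sigma> :: "real^'n \<Rightarrow> real^'m^'n"
  assumes sol: "solution_on \<sigma> (switch t a b) x I y"
    and "{c..d} \<subseteq> I" "s \<in> {c<..<d}" "s \<noteq> t"
  shows "(y has_vector_derivative \<sigma> (y s) *v switch t a b s) (at s)"
proof -
  have "(y has_vector_derivative \<sigma> (y s) *v switch t a b s) (at s within I)"
  proof -
    have "s \<in> I" using assms(2,3) by auto
    then show ?thesis
      using sol continuous_switch[OF assms(4), of "{0..}" a b] unfolding solution_on_def by blast
  qed
  then have "(y has_vector_derivative \<sigma> (y s) *v switch t a b s) (at s within {c<..<d})"
    by (rule has_vector_derivative_within_subset) (use assms(2) in auto)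
  then show ?thesis
    using assms(3) at_within_open[of s "{c<..<d}"] by simp
qed

lemma norm_matrix_vector_mult_le:
  fixes A :: "real^'m^'n"
  shows "norm (A *v x) \<le> norm A * norm x"
proof (rule power2_le_imp_le)
  have "(norm (A *v x))\<^sup>2 = (\<Sum>i\<in>UNIV. (A $ i \<bullet> x)\<^sup>2)"
    by (simp add: norm_vec_def L2_set_def sum_nonneg matrix_vector_mul_component)
  also have "\<dots> \<le> (\<Sum>i\<in>UNIV. (norm (A $ i) * norm x)\<^sup>2)"
    by (intro sum_mono power2_le_iff_abs_le[THEN iffD2])
      (auto intro: Cauchy_Schwarz_ineq2)
  also have "\<dots> = (norm A * norm x)\<^sup>2"
    by (simp add: norm_vec_def[of A] L2_set_def sum_nonneg power_mult_distrib sum_distrib_right)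
  finally show "(norm (A *v x))\<^sup>2 \<le> (norm A * norm x)\<^sup>2" .
qed simp

definition lipschitz_on_balls :: "('a::real_normed_vector \<Rightarrow> 'b::real_normed_vector) \<Rightarrow> bool" where
  "lipschitz_on_balls f \<longleftrightarrow> (\<forall>c R. \<exists>L\<ge>0. \<forall>x\<in>cball c R. \<forall>y\<in>cball c R.
     norm (f x - f y) \<le> L * norm (x - y))"

lemma lipschitz_matrix_vector:
  fixes \<sigma> :: "'a::real_normed_vector \<Rightarrow> real^'m^'n"
  assumes "norm (\<sigma> x - \<sigma> y) \<le> L * norm (x - y)" 
  shows "norm (\<sigma> x *v a - \<sigma> y *v a) \<le> L * norm a * norm (x - y)"
proof -
  have "norm (\<sigma> x *v a - \<sigma> y *v a) \<le> norm (\<sigma> x - \<sigma> y) * norm a"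
    using norm_matrix_vector_mult_le[of "\<sigma> x - \<sigma> y" a] by (simp add: matrix_vector_mult_diff_rdistrib)
  also have "\<dots> \<le> L * norm (x - y) * norm a"
    using assms by (intro mult_right_mono) auto
  finally show ?thesis by (simp add: mult_ac)
qed

text \<open>Both solutions stay in a common ball on \<open>{0..s}\<close>, where \<open>\<sigma>\<close> has a Lipschitz constant. The two arcs
  are compared in turn; the meeting point is clipped to \<open>{0..s}\<close> since the switching time may
  lie outside.\<close>
lemma solution_on_switch_unique:
  fixes \<sigma> :: "real^'n \<Rightarrow> real^'m^'n"
  assumes "lipschitz_on_balls \<sigma>"
    and y: "solution_on \<sigma> (switch t a b) x I y" and z: "solution_on \<sigma> (switch t a b) x J z"
    and s: "s \<in> I" "s \<in> J"
  shows "y s = z s"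
proof -
  have "0 \<le> s" "y 0 = z 0" using y z s by (auto simp: solution_on_def)
  have sub: "{0..s} \<subseteq> I" "{0..s} \<subseteq> J"
    using mem_is_interval_1_I[of _ 0 s] y z s by (auto simp: solution_on_def)
  have cont: "continuous_on {0..s} y" "continuous_on {0..s} z"
    using y z sub by (auto simp: solution_on_def intro: continuous_on_subset)
  then have "bounded (y ` {0..s} \<union> z ` {0..s})"
    by (intro bounded_Un[THEN iffD2] conjI compact_imp_bounded compact_continuous_image) auto
  then obtain R where "\<forall>p \<in> y ` {0..s} \<union> z ` {0..s}. norm p \<le> R"
    unfolding bounded_iff by blast
  then have R: "y r \<in> cball 0 R" "z r \<in> cball 0 R" if "r \<in> {0..s}" for r
    using that by auto
  obtain L where L: "\<And>p q. p \<in> cball 0 R \<Longrightarrow> q \<in> cball 0 R \<Longrightarrow> norm (\<sigma> p - \<sigma> q) \<le> L * norm (p - q)"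
    using assms(1) unfolding lipschitz_on_balls_def by blast
  define m where "m = max 0 (min t s)"
  have m: "0 \<le> m" "m \<le> s" using \<open>0 \<le> s\<close> by (auto simp: m_def)
  note agree = solutions_agree_at_endpoint[where B = "cball 0 R", OF lipschitz_matrix_vector[of \<sigma>, OF L]]
  have ym: "y m = z m"
  proof (rule agree[where y = y and z = z and c = 0])
    show "(y has_vector_derivative \<sigma> (y r) *v a) (at r)"
      "(z has_vector_derivative \<sigma> (z r) *v a) (at r)" if "r \<in> {0<..<m}" for r
      using solution_on_switch_derivative[OF y sub(1), of r]
        solution_on_switch_derivative[OF z sub(2), of r] that m
      by (auto simp: m_def max_def min_def split: if_splits)
  qed (use m R in \<open>auto intro: continuous_on_subset[OF cont(1)] continuous_on_subset[OF cont(2)]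
      simp: \<open>y 0 = z 0\<close>\<close>)
  show ?thesis
  proof (rule agree[where y = y and z = z and c = m])
    show "(y has_vector_derivative \<sigma> (y r) *v b) (at r)"
      "(z has_vector_derivative \<sigma> (z r) *v b) (at r)" if "r \<in> {m<..<s}" for r
      using solution_on_switch_derivative[OF y sub(1), of r]
        solution_on_switch_derivative[OF z sub(2), of r] that m
      by (auto simp: m_def max_def min_def split: if_splits)
  qed (use m R in \<open>auto intro: continuous_on_subset[OF cont(1)] continuous_on_subset[OF cont(2)]
      simp: ym\<close>)
qed

lemma tendsto_matrix_vector_mult:
  fixes A :: "'a \<Rightarrow> real^'m^'n"
  assumes "(A \<longlongrightarrow> B) F" "(v \<longlongrightarrow> w) F"
  shows "((\<lambda>s. A s *v v s) \<longlongrightarrow> B *v w) F"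
  unfolding matrix_vector_mult_def by (intro tendsto_intros assms)

lemma integrable_along_switch:
  fixes A :: "real \<Rightarrow> real^'m^'n"
  assumes "continuous_on {0..T} A" "0 \<le> T"
  shows "(\<lambda>s. A s *v switch t a b s) integrable_on {0..T}"
proof -
  define m where "m = max 0 (min t T)"
  have m: "0 \<le> m" "m \<le> T" using \<open>0 \<le> T\<close> by (auto simp: m_def)
  have cont: "continuous_on {0..T} (\<lambda>s. A s *v c)" for c
    using assms(1) unfolding continuous_on_def
    by (auto intro!: tendsto_matrix_vector_mult)
  show ?thesis
  proof (rule Henstock_Kurzweil_Integration.integrable_combine[OF m])
    have "(\<lambda>s. A s *v a) integrable_on {0..m}"
      using m by (intro integrable_continuous_real continuous_on_subset[OF cont]) auto
    then show "(\<lambda>s. A s *v switch t a b s) integrable_on {0..m}"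
      by (rule integrable_spike_finite[of "{m}", rotated 2]) (auto simp: m_def)
    have "(\<lambda>s. A s *v b) integrable_on {m..T}"
      using m by (intro integrable_continuous_real continuous_on_subset[OF cont]) auto
    then show "(\<lambda>s. A s *v switch t a b s) integrable_on {m..T}"
      by (rule integrable_spike_finite[of "{m}", rotated 2]) (auto simp: m_def)
  qed
qed

text \<open>The Picard iteration needs a globally Lipschitz field, so \<open>\<sigma>\<close> is composed with the projection onto
  the ball, which does not increase distances. A curve of speed at most \<open>M\<close> starting well inside the
  ball does not leave it before time \<open>T\<close>, and there the projection is the identity.\<close>
lemma short_solution_exists:
  fixes \<sigma> :: "real^'n \<Rightarrow> real^'m^'n"
  assumes lip: "\<And>p q. p \<in> cball c R \<Longrightarrow> q \<in> cball c R \<Longrightarrow> norm (\<sigma> p - \<sigma> q) \<le> L * norm (p - q)"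
    and bnd: "\<And>p. p \<in> cball c R \<Longrightarrow> norm (\<sigma> p) \<le> M"
    and "norm a \<le> 1" "norm b \<le> 1" "0 \<le> L" "0 \<le> M" "0 \<le> T" "L * T < 1"
    and x: "norm (x - c) + M * T \<le> R"
  obtains y where "solution_on \<sigma> (switch t a b) x {0..T} y" "y ` {0..T} \<subseteq> cball c R"
proof -
  define P where "P = closest_point (cball c R)"
  define f where "f s p = \<sigma> (P p) *v switch t a b s" for s p
  have "0 \<le> M * T" using \<open>0 \<le> M\<close> \<open>0 \<le> T\<close> by simp
  then have "0 \<le> R" using x norm_ge_zero[of "x - c"] by linarith
  then have ne: "cball c R \<noteq> {}" by simp
  have P: "P p \<in> cball c R" for p
    unfolding P_def by (rule closest_point_in_set[OF closed_cball ne])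
  have P_lip: "norm (P p - P q) \<le> norm (p - q)" for p q
    using closest_point_lipschitz[OF convex_cball closed_cball ne, of p q]
    by (simp add: P_def dist_norm)
  have sw: "norm (switch t a b s) \<le> 1" for s
    using assms(3,4) by simp
  have "continuous_on (cball c R) \<sigma>"
    using lip \<open>0 \<le> L\<close> by (intro lipschitz_on_continuous_on[of L] lipschitz_onI) (auto simp: dist_norm)
  then have "continuous_on UNIV (\<lambda>p. \<sigma> (P p))"
    using P continuous_on_closest_point[OF convex_cball closed_cball ne, of UNIV]
    by (auto simp: P_def intro: continuous_on_compose2)
  then have cont: "continuous_on {0..T} (\<lambda>s. \<sigma> (P (y s)))" if "continuous_on {0..T} y" for y
    using that by (auto intro: continuous_on_compose2)
  have int: "(\<lambda>s. f s (y s)) integrable_on {0..T}" if "continuous_on {0..T} y" for y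
    unfolding f_def by (intro integrable_along_switch cont that \<open>0 \<le> T\<close>)
  have f_lip: "norm (f s p - f s q) \<le> L * norm (p - q)" for s p q
  proof -
    have "norm (\<sigma> (P p) - \<sigma> (P q)) \<le> L * norm (p - q)"
      using lip[OF P P] P_lip[of p q] \<open>0 \<le> L\<close> by (meson mult_left_mono order_trans)
    then have "norm (f s p - f s q) \<le> L * norm (switch t a b s) * norm (p - q)"
      unfolding f_def by (rule lipschitz_matrix_vector[where \<sigma> = "\<lambda>p. \<sigma> (P p)"])
    also have "\<dots> \<le> L * 1 * norm (p - q)"
      by (intro mult_right_mono mult_left_mono sw \<open>0 \<le> L\<close> norm_ge_zero)
    finally show ?thesis by simp
  qed
  obtain y where y: "continuous_on {0..T} y"
    and y_eq: "\<And>s. s \<in> {0..T} \<Longrightarrow> y s = x + integral {0..s} (\<lambda>r. f r (y r))"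
    using picard_short_time[OF \<open>0 \<le> T\<close> \<open>0 \<le> L\<close> \<open>L * T < 1\<close> f_lip int, of x] by blast
  have f_bnd: "norm (f s p) \<le> M" for s p
  proof -
    have "norm (f s p) \<le> norm (\<sigma> (P p)) * norm (switch t a b s)"
      unfolding f_def by (rule norm_matrix_vector_mult_le)
    also have "\<dots> \<le> M * 1"
      by (intro mult_mono bnd P sw \<open>0 \<le> M\<close> norm_ge_zero)
    finally show ?thesis by simp
  qed
  have y_ball: "y s \<in> cball c R" if s: "s \<in> {0..T}" for s
  proof -
    have "(\<lambda>r. f r (y r)) integrable_on {0..s}"
      using s by (intro integrable_subinterval_real[OF int[OF y]]) auto
    then have "norm (integral {0..s} (\<lambda>r. f r (y r))) \<le> M * s"
      using has_integral_bound_real[OF \<open>0 \<le> M\<close> _ integrable_integral, of "{}" "\<lambda>r. f r (y r)" 0 s]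
        f_bnd s by auto
    also have "\<dots> \<le> M * T"
      using s \<open>0 \<le> M\<close> by (auto intro: mult_left_mono)
    finally have "norm (y s - x) \<le> M * T"
      using y_eq[OF s] by simp
    then show ?thesis
      using x norm_triangle_ineq[of "y s - x" "x - c"] by (simp add: dist_norm norm_minus_commute)
  qed
  have f_eq: "f s (y s) = \<sigma> (y s) *v switch t a b s" if "s \<in> {0..T}" for s
    unfolding f_def P_def using closest_point_self[OF y_ball[OF that]] by simp
  have "(y has_vector_derivative \<sigma> (y s) *v switch t a b s) (at s within {0..T})"
    if s: "s \<in> {0..T}" and c: "continuous (at s within {0..}) (switch t a b)" for s
  proof -
    have "((\<lambda>r. f r (y r)) \<longlongrightarrow> f s (y s)) (at s within {0..T})"
      unfolding f_def
    proof (rule tendsto_matrix_vector_mult)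
      show "((\<lambda>r. \<sigma> (P (y r))) \<longlongrightarrow> \<sigma> (P (y s))) (at s within {0..T})"
        using cont[OF y] s by (simp add: continuous_on_def)
      show "(switch t a b \<longlongrightarrow> switch t a b s) (at s within {0..T})"
        using c unfolding continuous_within by (rule tendsto_within_subset) auto
    qed
    then have "((\<lambda>r. integral {0..r} (\<lambda>r. f r (y r))) has_vector_derivative f s (y s)) (at s within {0..T})"
      using integral_has_vector_derivative_continuous_at[OF int[OF y], of s "{}"] s
      by (simp add: continuous_within)
    then have "((\<lambda>r. x + integral {0..r} (\<lambda>r. f r (y r))) has_vector_derivative f s (y s)) (at s within {0..T})"
      by (auto intro!: derivative_eq_intros)
    then have "(y has_vector_derivative f s (y s)) (at s within {0..T})"
      by (rule has_vector_derivative_transform[OF s, rotated]) (simp add: y_eq)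
    then show ?thesis by (simp add: f_eq[OF s])
  qed
  then have "solution_on \<sigma> (switch t a b) x {0..T} y"
    using y y_eq[of 0] \<open>0 \<le> T\<close> by (auto simp: solution_on_def is_interval_cc)
  then show ?thesis using that y_ball by blast
qed

section \<open>Consequences of the smoothness assumptions\<close>

lemma class_C_SucD: "class_C (Suc k) f \<Longrightarrow> class_C k f"
proof (induction k arbitrary: f)
  case 0
  then show ?case
    by (auto intro!: continuous_at_imp_continuous_on differentiable_imp_continuous_within)
next
  case (Suc k)
  then show ?case by simp
qed

lemma class_C_mono: "\<lbrakk>class_C k f; j \<le> k\<rbrakk> \<Longrightarrow> class_C j f"
  by (induction k) (use class_C_SucD le_SucE in blast)+

lemma frechet_derivative_basis_sum:
  fixes f :: "'a::euclidean_space \<Rightarrow> 'b::euclidean_space"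
  assumes "f differentiable at x"
  shows "frechet_derivative f (at x) v = (\<Sum>b\<in>Basis. (v \<bullet> b) *\<^sub>R frechet_derivative f (at x) b)"
proof -
  have "frechet_derivative f (at x) v = frechet_derivative f (at x) (\<Sum>b\<in>Basis. (v \<bullet> b) *\<^sub>R b)"
    by (simp add: euclidean_representation)
  also have "\<dots> = (\<Sum>b\<in>Basis. (v \<bullet> b) *\<^sub>R frechet_derivative f (at x) b)"
    using linear_frechet_derivative[OF assms] by (simp add: linear_sum linear_scale)
  finally show ?thesis .
qed

lemma class_C_1_continuous_derivative:
  fixes f :: "'a::euclidean_space \<Rightarrow> 'b::euclidean_space"
  assumes "class_C (Suc 0) f" "continuous_on UNIV w"
  shows "continuous_on UNIV (\<lambda>x. frechet_derivative f (at x) (w x))"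
proof -
  have eq: "(\<lambda>x. frechet_derivative f (at x) (w x))
      = (\<lambda>x. \<Sum>b\<in>Basis. (w x \<bullet> b) *\<^sub>R frechet_derivative f (at x) b)"
    using assms(1) by (intro ext frechet_derivative_basis_sum) simp
  have "continuous_on UNIV (\<lambda>x. frechet_derivative f (at x) b)" for b
    using assms(1) by simp
  then show ?thesis
    unfolding eq by (intro continuous_intros assms(2))
qed

text \<open>The operator norm of the derivative is at most the sum of the norms of the partial derivatives,
  each of which is bounded on a ball by compactness.\<close>
lemma class_C_1_lipschitz:
  fixes f :: "'a::euclidean_space \<Rightarrow> 'b::euclidean_space"
  assumes "class_C (Suc 0) f"
  shows "lipschitz_on_balls f"
  unfolding lipschitz_on_balls_def
proof (intro allI)
  fix c :: 'a and R :: real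
  have "\<exists>B. \<forall>x\<in>cball c R. norm (frechet_derivative f (at x) b) \<le> B" for b
  proof -
    have "compact ((\<lambda>x. frechet_derivative f (at x) b) ` cball c R)"
      using assms by (intro compact_continuous_image) (auto intro: continuous_on_subset)
    then have "bounded ((\<lambda>x. frechet_derivative f (at x) b) ` cball c R)"
      by (rule compact_imp_bounded)
    then show ?thesis
      by (simp add: bounded_iff)
  qed
  then obtain B where B: "\<And>b x. x \<in> cball c R \<Longrightarrow> norm (frechet_derivative f (at x) b) \<le> B b"
    by metis
  define L where "L = (\<Sum>b\<in>Basis. \<bar>B b\<bar>)"
  have on: "onorm (frechet_derivative f (at x)) \<le> L" if x: "x \<in> cball c R" for x
  proof (rule onorm_le)
    fix v
    have "norm (frechet_derivative f (at x) v)
        = norm (\<Sum>b\<in>Basis. (v \<bullet> b) *\<^sub>R frechet_derivative f (at x) b)"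
      using assms by (subst frechet_derivative_basis_sum) auto
    also have "\<dots> \<le> (\<Sum>b\<in>Basis. \<bar>B b\<bar> * norm v)"
    proof (rule sum_norm_le)
      fix b :: 'a assume "b \<in> Basis"
      then have "\<bar>v \<bullet> b\<bar> * norm (frechet_derivative f (at x) b) \<le> norm v * \<bar>B b\<bar>"
        using B[OF x, of b] by (intro mult_mono) (auto intro: Basis_le_norm)
      then show "norm ((v \<bullet> b) *\<^sub>R frechet_derivative f (at x) b) \<le> \<bar>B b\<bar> * norm v"
        by (simp add: mult.commute)
    qed
    finally show "norm (frechet_derivative f (at x) v) \<le> L * norm v"
      by (simp add: L_def sum_distrib_right)
  qed
  have fd: "(f has_derivative frechet_derivative f (at x)) (at x within cball c R)" for x
    using assms by (auto simp: frechet_derivative_works intro: has_derivative_at_withinI)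
  have "norm (f x - f y) \<le> L * norm (x - y)" if "x \<in> cball c R" "y \<in> cball c R" for x y
    by (rule differentiable_bound[OF convex_cball fd on that])
  moreover have "0 \<le> L" by (simp add: L_def sum_nonneg)
  ultimately show "\<exists>L\<ge>0. \<forall>x\<in>cball c R. \<forall>y\<in>cball c R. norm (f x - f y) \<le> L * norm (x - y)"
    by blast
qed

lemma inner_grad:
  fixes u :: "'a::euclidean_space \<Rightarrow> real"
  assumes "u differentiable at x"
  shows "grad u x \<bullet> v = frechet_derivative u (at x) v"
proof -
  define D where "D = (\<Sum>b\<in>Basis. frechet_derivative u (at x) b *\<^sub>R b)"
  have D: "v \<bullet> D = frechet_derivative u (at x) v" for v
    using frechet_derivative_basis_sum[OF assms, of v]
    by (simp add: D_def inner_sum_right mult.commute)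
  have "GDERIV u x :> D"
    using assms unfolding gderiv_def D frechet_derivative_works .
  then have "grad u x = D" by (rule grad_eqI)
  then show ?thesis using D by (metis inner_commute)
qed

lemma grad_along_inner:
  fixes u :: "real^'n \<Rightarrow> real" and \<sigma> :: "real^'n \<Rightarrow> real^'m^'n"
  assumes "u differentiable at x"
  shows "grad_along u \<sigma> x \<bullet> a = frechet_derivative u (at x) (\<sigma> x *v a)"
proof -
  have "grad_along u \<sigma> x \<bullet> a = grad u x \<bullet> (\<Sum>i\<in>UNIV. a $ i *\<^sub>R column i (\<sigma> x))"
    by (simp add: grad_along_def inner_vec_def[of "vec_lambda _"] inner_sum_right mult.commute)
  also have "(\<Sum>i\<in>UNIV. a $ i *\<^sub>R column i (\<sigma> x)) = \<sigma> x *v a"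
    by (simp add: matrix_mult_sum scalar_mult_eq_scaleR)
  finally show ?thesis using inner_grad[OF assms] by simp
qed

text \<open>The components of \<open>grad_along u \<sigma>\<close> are sums of products of partial derivatives of \<open>u\<close> with entries
  of \<open>\<sigma>\<close>, all of class \<open>C\<^sup>1\<close>. Continuity of the derivative is stated for a direction that moves with the
  point because \<open>S a\<close> is the derivative of \<open>grad_along u \<sigma>\<close> in the direction \<open>\<sigma> x *v a\<close>.\<close>
lemma grad_along_C1:
  fixes u :: "real^'n \<Rightarrow> real" and \<sigma> :: "real^'n \<Rightarrow> real^'m^'n"
  assumes "class_C 1 \<sigma>" "class_C 2 u"
  shows "grad_along u \<sigma> differentiable at x"
    and "continuous_on UNIV w \<Longrightarrow>
      continuous_on UNIV (\<lambda>x. frechet_derivative (grad_along u \<sigma>) (at x) (w x))"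
proof -
  define p where "p k x = frechet_derivative u (at x) (axis k 1)" for k :: 'n and x
  have p: "class_C (Suc 0) (p k)" for k
    using assms(2) by (simp add: p_def[abs_def] numeral_2_eq_2)
  have \<sigma>: "class_C (Suc 0) \<sigma>" using assms(1) by simp
  have g: "grad_along u \<sigma> = (\<lambda>x. \<chi> i. \<Sum>k\<in>UNIV. p k x * \<sigma> x $ k $ i)"
  proof (intro ext, subst vec_eq_iff, intro allI)
    fix x i
    have "u differentiable at x" using assms(2) by (simp add: numeral_2_eq_2)
    have "grad_along u \<sigma> x $ i = grad u x \<bullet> column i (\<sigma> x)"
      by (simp add: grad_along_def)
    also have "\<dots> = (\<Sum>k\<in>UNIV. grad u x $ k * \<sigma> x $ k $ i)"
      by (simp add: inner_vec_def column_def)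
    also have "\<dots> = (\<Sum>k\<in>UNIV. p k x * \<sigma> x $ k $ i)"
      using inner_grad[OF \<open>u differentiable at x\<close>] by (metis p_def inner_axis inner_real_def mult.right_neutral)
    finally show "grad_along u \<sigma> x $ i = (\<chi> i. \<Sum>k\<in>UNIV. p k x * \<sigma> x $ k $ i) $ i" by simp
  qed
  have p_d: "(p k has_derivative frechet_derivative (p k) (at x)) (at x)" for k x
    using p[of k] by (simp add: frechet_derivative_works)
  have \<sigma>_d: "(\<sigma> has_derivative frechet_derivative \<sigma> (at x)) (at x)" for x
    using \<sigma> by (simp add: frechet_derivative_works)
  have d: "(grad_along u \<sigma> has_derivative (\<lambda>v. \<chi> i. \<Sum>k\<in>UNIV.
      p k x * frechet_derivative \<sigma> (at x) v $ k $ i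
      + frechet_derivative (p k) (at x) v * \<sigma> x $ k $ i)) (at x)" for x
    unfolding g
    by (subst has_derivative_componentwise_within)
      (auto simp: Basis_vec_def inner_axis intro!: has_derivative_sum has_derivative_mult p_d
        bounded_linear.has_derivative[OF bounded_linear_vec_nth] \<sigma>_d)
  show "grad_along u \<sigma> differentiable at x"
    using d unfolding differentiable_def by blast
  assume w: "continuous_on UNIV w"
  have "continuous_on UNIV (p k)" "continuous_on UNIV \<sigma>" for k
    using class_C_SucD[OF p] class_C_SucD[OF \<sigma>] by auto
  then show "continuous_on UNIV (\<lambda>x. frechet_derivative (grad_along u \<sigma>) (at x) (w x))"
    using class_C_1_continuous_derivative[OF p w] class_C_1_continuous_derivative[OF \<sigma> w]
    unfolding frechet_derivative_at[OF d, symmetric]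
    by (intro continuous_intros) 
qed

text \<open>This identifies \<open>S a\<close> as the rate of change of \<open>grad_along u \<sigma>\<close> along a trajectory with control \<open>a\<close>.\<close>
lemma S_mat_vector_mult:
  fixes u :: "real^'n \<Rightarrow> real" and \<sigma> :: "real^'n \<Rightarrow> real^'m^'n"
  assumes "grad_along u \<sigma> differentiable at x"
  shows "S_mat u \<sigma> x *v a = frechet_derivative (grad_along u \<sigma>) (at x) (\<sigma> x *v a)"
proof -
  have "(*v) (jacobian (grad_along u \<sigma>) (at x)) = frechet_derivative (grad_along u \<sigma>) (at x)"
    using assms frechet_derivative_at jacobian_works by blast
  then show ?thesis
    unfolding S_mat_def by (metis matrix_vector_mul_assoc)
qed

section \<open>Expansion of the target function along a trajectory\<close>

text \<open>One arc with constant control \<open>a\<close>, on which \<open>S a\<close> is close to a fixed vector \<open>w\<close>. The mean value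
  inequality bounds the first order error of \<open>grad_along u \<sigma>\<close>; since \<open>grad_along u \<sigma> \<bullet> a\<close> is the derivative of
  \<open>u\<close> along the arc, integrating this bound once more gives the second order estimate for \<open>u\<close>.\<close>
lemma arc_estimates:
  fixes \<sigma> :: "real^'n \<Rightarrow> real^'m^'n" and u :: "real^'n \<Rightarrow> real"
  assumes u: "\<And>x. u differentiable at x" and g: "\<And>x. grad_along u \<sigma> differentiable at x"
    and y: "continuous_on {c..d} y"
      "\<And>s. s \<in> {c<..<d} \<Longrightarrow> (y has_vector_derivative \<sigma> (y s) *v a) (at s)"
    and S: "\<And>s. s \<in> {c<..<d} \<Longrightarrow> norm (S_mat u \<sigma> (y s) *v a - w) \<le> e"
    and "norm a \<le> 1" "c \<le> d"
  shows "norm (grad_along u \<sigma> (y d) - grad_along u \<sigma> (y c) - (d - c) *\<^sub>R w) \<le> e * (d - c)"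
    and "u (y d) \<le> u (y c) + (d - c) * (grad_along u \<sigma> (y c) \<bullet> a)
      + (d - c)\<^sup>2 / 2 * (w \<bullet> a) + e * (d - c)\<^sup>2 / 2"
proof -
  let ?g = "grad_along u \<sigma>"
  have cont: "continuous_on {c..d} (\<lambda>s. ?g (y s))" "continuous_on {c..d} (\<lambda>s. u (y s))"
    by (rule continuous_on_compose2[OF _ y(1) subset_UNIV],
        intro continuous_at_imp_continuous_on ballI differentiable_imp_continuous_within g u)+
  have chain: "((\<lambda>s. f (y s)) has_vector_derivative frechet_derivative f (at (y s)) (\<sigma> (y s) *v a)) (at s)"
    if "s \<in> {c<..<d}" "f differentiable at (y s)" for s and f :: "real^'n \<Rightarrow> 'b::real_normed_vector"
    using vector_derivative_diff_chain_within[OF y(2)[OF that(1)], of f "frechet_derivative f (at (y s))"] that(2)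
    by (simp add: frechet_derivative_works has_derivative_at_withinI o_def)
  have G: "norm (?g (y s) - ?g (y c) - (s - c) *\<^sub>R w) \<le> e * (s - c)" if s: "s \<in> {c..d}" for s
  proof (cases "c = s")
    case False
    define f where "f r = ?g (y r) - (r - c) *\<^sub>R w" for r
    have "norm (f s - f c) \<le> e * s - e * c"
    proof (rule differentiable_bound_general[where f = f and \<phi> = "\<lambda>r. e * r"])
      show "c < s" using s False by simp
      show "continuous_on {c..s} f"
        unfolding f_def using s by (intro continuous_intros continuous_on_subset[OF cont(1)]) auto
      show "continuous_on {c..s} (\<lambda>r. e * r)" by (intro continuous_intros)
      fix r assume r: "c < r" "r < s"
      then have "r \<in> {c<..<d}" using s by auto
      then have "((\<lambda>s. ?g (y s)) has_vector_derivative S_mat u \<sigma> (y r) *v a) (at r)"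
        using chain[OF _ g] S_mat_vector_mult[OF g] by simp
      then show "(f has_vector_derivative S_mat u \<sigma> (y r) *v a - w) (at r)"
        unfolding f_def by (auto intro!: derivative_eq_intros)
      show "((\<lambda>r. e * r) has_vector_derivative e) (at r)"
        by (auto intro!: derivative_eq_intros)
      show "norm (S_mat u \<sigma> (y r) *v a - w) \<le> e"
        using S \<open>r \<in> {c<..<d}\<close> by blast
    qed
    then show ?thesis by (simp add: f_def algebra_simps)
  qed simp
  then show "norm (?g (y d) - ?g (y c) - (d - c) *\<^sub>R w) \<le> e * (d - c)"
    using \<open>c \<le> d\<close> by simp
  define \<phi> where "\<phi> s = u (y s) - (s - c) * (?g (y c) \<bullet> a) - (s - c)\<^sup>2 / 2 * (w \<bullet> a) - e * (s - c)\<^sup>2 / 2" for s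
  \<comment> \<open>Instead of integrating, subtract the claimed bound: its derivative dominates that of \<open>u \<circ> y\<close>.\<close>
  have "\<phi> d \<le> \<phi> c"
  proof (rule DERIV_nonpos_imp_decreasing_open[OF \<open>c \<le> d\<close>])
    show "continuous_on {c..d} \<phi>"
      unfolding \<phi>_def by (intro continuous_intros cont(2)) auto
    fix s assume s: "c < s" "s < d"
    define k where "k = ?g (y s) \<bullet> a - ?g (y c) \<bullet> a - (s - c) * (w \<bullet> a) - e * (s - c)"
    have "((\<lambda>s. u (y s)) has_real_derivative ?g (y s) \<bullet> a) (at s)"
      using chain[OF _ u, of s] s
      by (simp add: grad_along_inner[OF u] has_real_derivative_iff_has_vector_derivative)
    then have "(\<phi> has_real_derivative k) (at s)"
      unfolding \<phi>_def by (auto intro!: derivative_eq_intros simp: k_def field_simps)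
    moreover have "k \<le> 0"
    proof -
      have "(?g (y s) - ?g (y c) - (s - c) *\<^sub>R w) \<bullet> a
          \<le> norm (?g (y s) - ?g (y c) - (s - c) *\<^sub>R w) * norm a"
        by (rule norm_cauchy_schwarz)
      also have "\<dots> \<le> norm (?g (y s) - ?g (y c) - (s - c) *\<^sub>R w) * 1"
        using \<open>norm a \<le> 1\<close> by (intro mult_left_mono) auto
      also have "\<dots> \<le> e * (s - c)" using G[of s] s by simp
      finally show ?thesis by (simp add: k_def inner_diff_left)
    qed
    ultimately show "\<exists>k. (\<phi> has_real_derivative k) (at s) \<and> k \<le> 0" by blast
  qed
  then show "u (y d) \<le> u (y c) + (d - c) * (?g (y c) \<bullet> a) + (d - c)\<^sup>2 / 2 * (w \<bullet> a) + e * (d - c)\<^sup>2 / 2"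
    by (simp add: \<phi>_def)
qed

text \<open>The mixed term \<open>(M *v a) \<bullet> b\<close> comes from the value of \<open>grad_along u \<sigma>\<close> at the start of the second arc,
  which the first arc has changed by about \<open>t *\<^sub>R (M *v a)\<close>. The error \<open>2 * e * t\<^sup>2\<close> is \<open>e * t\<^sup>2 / 2\<close> from each
  arc and \<open>e * t\<^sup>2\<close> from that change.\<close>
lemma two_arc_estimate:
  fixes \<sigma> :: "real^'n \<Rightarrow> real^'m^'n" and u :: "real^'n \<Rightarrow> real"
  assumes u: "\<And>x. u differentiable at x" and g: "\<And>x. grad_along u \<sigma> differentiable at x"
    and y: "solution_on \<sigma> (switch t a b) x {0..2 * t} y" and "0 \<le> t"
    and S: "\<And>s. s \<in> {0..2 * t} \<Longrightarrow> norm (S_mat u \<sigma> (y s) *v a - M *v a) \<le> e"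
      "\<And>s. s \<in> {0..2 * t} \<Longrightarrow> norm (S_mat u \<sigma> (y s) *v b - M *v b) \<le> e"
    and ab: "norm a \<le> 1" "norm b \<le> 1"
  shows "u (y (2 * t)) \<le> u x + t * (grad_along u \<sigma> x \<bullet> (a + b))
    + t\<^sup>2 / 2 * ((M *v a) \<bullet> a + 2 * ((M *v a) \<bullet> b) + (M *v b) \<bullet> b) + 2 * e * t\<^sup>2"
proof -
  let ?g = "grad_along u \<sigma>"
  have cont: "continuous_on {0..2 * t} y" and "y 0 = x"
    using y by (auto simp: solution_on_def)
  note d = solution_on_switch_derivative[OF y]
  have da: "(y has_vector_derivative \<sigma> (y s) *v a) (at s)" if "s \<in> {0<..<t}" for s
    using d[of 0 "2 * t" s] that \<open>0 \<le> t\<close> by auto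
  have cont1: "continuous_on {0..t} y"
    using \<open>0 \<le> t\<close> by (intro continuous_on_subset[OF cont]) auto
  have Sa: "norm (S_mat u \<sigma> (y s) *v a - M *v a) \<le> e" if "s \<in> {0<..<t}" for s
    using S(1) that by auto
  have 1: "norm (?g (y t) - ?g (y 0) - (t - 0) *\<^sub>R (M *v a)) \<le> e * (t - 0)"
    by (rule arc_estimates(1)[OF u g cont1 da Sa ab(1) \<open>0 \<le> t\<close>])
  have 2: "u (y t) \<le> u (y 0) + (t - 0) * (?g (y 0) \<bullet> a) + (t - 0)\<^sup>2 / 2 * ((M *v a) \<bullet> a) + e * (t - 0)\<^sup>2 / 2"
    by (rule arc_estimates(2)[OF u g cont1 da Sa ab(1) \<open>0 \<le> t\<close>])
  have 3: "u (y (2 * t)) \<le> u (y t) + (2 * t - t) * (?g (y t) \<bullet> b)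
      + (2 * t - t)\<^sup>2 / 2 * ((M *v b) \<bullet> b) + e * (2 * t - t)\<^sup>2 / 2"
  proof (rule arc_estimates(2)[OF u g _ _ _ ab(2)])
    show "(y has_vector_derivative \<sigma> (y s) *v b) (at s)" if "s \<in> {t<..<2 * t}" for s
      using d[of 0 "2 * t" s] that \<open>0 \<le> t\<close> by auto
  qed (use S \<open>0 \<le> t\<close> in \<open>auto intro: continuous_on_subset[OF cont]\<close>)
  have "(?g (y t) - ?g x - t *\<^sub>R (M *v a)) \<bullet> b \<le> norm (?g (y t) - ?g x - t *\<^sub>R (M *v a)) * norm b"
    by (rule norm_cauchy_schwarz)
  also have "\<dots> \<le> e * t * 1"
    using 1 ab(2) \<open>y 0 = x\<close> order_trans[OF norm_ge_zero 1] by (intro mult_mono) auto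
  finally have "?g (y t) \<bullet> b \<le> ?g x \<bullet> b + t * ((M *v a) \<bullet> b) + e * t"
    by (simp add: inner_diff_left)
  then have "t * (?g (y t) \<bullet> b) \<le> t * (?g x \<bullet> b + t * ((M *v a) \<bullet> b) + e * t)"
    using \<open>0 \<le> t\<close> by (rule mult_left_mono)
  then show ?thesis
    using 2 3 \<open>y 0 = x\<close> by (simp add: inner_add_right algebra_simps power2_eq_square)
qed

section \<open>Reaching the target in time of order \<open>sqrt \<bar>x - xb\<bar>\<close>\<close>

lemma differentiable_imp_lipschitz_at_point:
  fixes f :: "'a::real_normed_vector \<Rightarrow> 'b::real_normed_vector"
  assumes "f differentiable at x"
  obtains A \<delta> where "A > 0" "\<delta> > 0" "\<And>y. norm (y - x) < \<delta> \<Longrightarrow> norm (f y - f x) \<le> A * norm (y - x)"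
proof -
  obtain f' where f': "bounded_linear f'"
    and alt: "\<forall>e>0. \<exists>d>0. \<forall>y. norm (y - x) < d \<longrightarrow> norm (f y - f x - f' (y - x)) \<le> e * norm (y - x)"
    using assms unfolding differentiable_def has_derivative_at_alt by blast
  obtain d where d: "d > 0" "\<And>y. norm (y - x) < d \<Longrightarrow> norm (f y - f x - f' (y - x)) \<le> 1 * norm (y - x)"
    using alt zero_less_one by blast
  show ?thesis
  proof
    show "onorm f' + 1 > 0" using onorm_pos_le[OF f'] by simp
    show "d > 0" by fact
    fix y assume "norm (y - x) < d"
    then have "norm (f y - f x) \<le> 1 * norm (y - x) + norm (f' (y - x))"
      using d(2)[of y] norm_triangle_sub[of "f y - f x" "f' (y - x)"] by linarith
    also have "\<dots> \<le> (onorm f' + 1) * norm (y - x)"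
      using onorm[OF f', of "y - x"] by (simp add: algebra_simps)
    finally show "norm (f y - f x) \<le> (onorm f' + 1) * norm (y - x)" .
  qed
qed

text \<open>Here \<open>d = \<bar>x - xb\<bar>\<close> and \<open>- q\<close> is the value of the quadratic form. With \<open>S\<close> within \<open>q / 8\<close> of its value at
  \<open>xb\<close>, the expansion reads \<open>u (y (2 * t)) \<le> u x + t * (g x \<bullet> (a + b)) - q / 4 * t\<^sup>2\<close>. For \<open>t \<le> 1/2\<close> the first
  two terms exceed \<open>u xb\<close> by at most \<open>A * d\<close>, which \<open>t = C * sqrt d\<close> with \<open>C\<^sup>2 = 4 * A / q\<close> exactly compensates.\<close>
lemma target_reached_near:
  fixes \<sigma> :: "real^'n \<Rightarrow> real^'m^'n" and u :: "real^'n \<Rightarrow> real"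
  assumes \<sigma>: "class_C 1 \<sigma>" and u: "class_C 2 u" and "grad_along u \<sigma> xb = 0"
    and ab: "norm a \<le> 1" "norm b \<le> 1"
    and neg: "(S_mat u \<sigma> xb *v a) \<bullet> a + 2 * ((S_mat u \<sigma> xb *v a) \<bullet> b) + (S_mat u \<sigma> xb *v b) \<bullet> b < 0"
  obtains C r where "C > 0" "r > 0"
    "\<And>x t I y. \<lbrakk>norm (x - xb) \<le> r; t = C * sqrt (norm (x - xb));
        trajectory \<sigma> (switch t a b) x I y\<rbrakk> \<Longrightarrow> 2 * t \<in> I \<and> u (y (2 * t)) \<le> u xb"
proof -
  let ?g = "grad_along u \<sigma>" and ?S = "S_mat u \<sigma>"
  define q where "q = - ((?S xb *v a) \<bullet> a + 2 * ((?S xb *v a) \<bullet> b) + (?S xb *v b) \<bullet> b)"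
  have "q > 0" using neg by (simp add: q_def)
  have u_d: "u differentiable at x" for x
    using u by (simp add: numeral_2_eq_2)
  note g_d = grad_along_C1(1)[OF \<sigma> u]
  have \<sigma>_C1: "class_C (Suc 0) \<sigma>" using \<sigma> by simp
  have lip: "lipschitz_on_balls \<sigma>" by (rule class_C_1_lipschitz[OF \<sigma>_C1])
  have \<sigma>_cont: "continuous_on UNIV \<sigma>" using class_C_SucD[OF \<sigma>_C1] by simp
  have S_near: "\<exists>R>0. \<forall>x. dist x xb < R \<longrightarrow> norm (?S x *v v - ?S xb *v v) < q / 8" for v
  proof -
    have "continuous_on UNIV (\<lambda>x. \<sigma> x *v v)"
      using \<sigma>_cont unfolding continuous_on_def by (auto intro!: tendsto_matrix_vector_mult)
    then have "continuous_on UNIV (\<lambda>x. ?S x *v v)"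
      unfolding S_mat_vector_mult[OF g_d] by (rule grad_along_C1(2)[OF \<sigma> u])
    then have "(\<lambda>x. ?S x *v v) \<midarrow>xb\<rightarrow> ?S xb *v v"
      by (simp add: continuous_on_def)
    then obtain R where "R > 0" "\<forall>x. x \<noteq> xb \<and> dist x xb < R \<longrightarrow> dist (?S x *v v) (?S xb *v v) < q / 8"
      unfolding LIM_def using \<open>q > 0\<close> by (metis divide_pos_pos zero_less_numeral)
    then show ?thesis
      using \<open>q > 0\<close> by (metis diff_self dist_norm divide_pos_pos norm_zero zero_less_numeral)
  qed
  obtain R1 R2 where R12: "R1 > 0" "R2 > 0"
    "\<And>x. dist x xb < R1 \<Longrightarrow> norm (?S x *v a - ?S xb *v a) < q / 8"
    "\<And>x. dist x xb < R2 \<Longrightarrow> norm (?S x *v b - ?S xb *v b) < q / 8"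
    using S_near by metis
  define R where "R = min R1 R2 / 2"
  have "R > 0" using R12 by (simp add: R_def)
  have near: "norm (?S x *v a - ?S xb *v a) \<le> q / 8" "norm (?S x *v b - ?S xb *v b) \<le> q / 8"
    if "x \<in> cball xb R" for x
  proof -
    have "dist x xb < R1" "dist x xb < R2"
      using that R12 by (auto simp: R_def dist_commute)
    then show "norm (?S x *v a - ?S xb *v a) \<le> q / 8" "norm (?S x *v b - ?S xb *v b) \<le> q / 8"
      using R12 less_imp_le by blast+
  qed
  obtain L where "L \<ge> 0" and L: "\<And>x y. x \<in> cball xb R \<Longrightarrow> y \<in> cball xb R \<Longrightarrow> norm (\<sigma> x - \<sigma> y) \<le> L * norm (x - y)"
    using lip unfolding lipschitz_on_balls_def by blast
  have "bounded (\<sigma> ` cball xb R)"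
    by (intro compact_imp_bounded compact_continuous_image continuous_on_subset[OF \<sigma>_cont]) auto
  then obtain M where "M > 0" and M: "\<And>x. x \<in> cball xb R \<Longrightarrow> norm (\<sigma> x) \<le> M"
    unfolding bounded_pos by auto
  obtain A1 d1 where A1: "A1 > 0" "d1 > 0"
    "\<And>x. norm (x - xb) < d1 \<Longrightarrow> norm (u x - u xb) \<le> A1 * norm (x - xb)"
    using differentiable_imp_lipschitz_at_point[OF u_d] by blast
  obtain A2 d2 where A2: "A2 > 0" "d2 > 0"
    "\<And>x. norm (x - xb) < d2 \<Longrightarrow> norm (?g x - ?g xb) \<le> A2 * norm (x - xb)"
    using differentiable_imp_lipschitz_at_point[OF g_d] by blast
  define A where "A = A1 + A2"
  define C where "C = sqrt (4 * A / q)"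
  have "A > 0" using A1 A2 by (simp add: A_def)
  then have "C > 0" and C2: "C\<^sup>2 = 4 * A / q" using \<open>q > 0\<close> by (auto simp: C_def)
  \<comment> \<open>The three bounds on \<open>t\<close> serve, in this order: the linear term of the expansion,
    the contraction condition \<open>L * (2 * t) < 1\<close>, and staying in the
    ball, \<open>M * (2 * t) \<le> R / 2\<close>.\<close>
  define \<tau> where "\<tau> = min (1/2) (min (1 / (4 * (L + 1))) (R / (4 * M)))"
  have "\<tau> > 0" using \<open>L \<ge> 0\<close> \<open>M > 0\<close> \<open>R > 0\<close> by (simp add: \<tau>_def)
  define r where "r = min (min (R / 2) ((\<tau> / C)\<^sup>2)) (min (d1 / 2) (d2 / 2))"
  have "r > 0" using \<open>R > 0\<close> \<open>\<tau> > 0\<close> \<open>C > 0\<close> A1 A2 by (simp add: r_def)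
  show ?thesis
  proof
    show "C > 0" "r > 0" by fact+
    fix x t I y
    assume x: "norm (x - xb) \<le> r" and t: "t = C * sqrt (norm (x - xb))"
      and traj: "trajectory \<sigma> (switch t a b) x I y"
    define d where "d = norm (x - xb)"
    have d: "0 \<le> d" "d \<le> R / 2" "d \<le> (\<tau> / C)\<^sup>2" "d < d1" "d < d2"
      using x A1 A2 by (auto simp: d_def r_def)
    have "0 \<le> t" using \<open>C > 0\<close> d by (simp add: t d_def)
    have "sqrt d \<le> \<tau> / C"
      using d(3) \<open>\<tau> > 0\<close> \<open>C > 0\<close> by (intro real_le_lsqrt) auto
    then have "t \<le> \<tau>" using \<open>C > 0\<close> by (simp add: t d_def[symmetric] field_simps)
    have t2: "t\<^sup>2 = 4 * A / q * d"
      using d C2 by (simp add: t d_def[symmetric] power_mult_distrib)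
    have "t \<le> 1/2" "t \<le> 1 / (4 * (L + 1))" "t \<le> R / (4 * M)"
      using \<open>t \<le> \<tau>\<close> by (auto simp: \<tau>_def)
    then have "4 * (L * t) + 4 * t \<le> 1" and Mt: "4 * (M * t) \<le> R"
      using \<open>L \<ge> 0\<close> \<open>M > 0\<close> by (simp_all add: field_simps)
    then have Lt: "L * (2 * t) < 1" using \<open>0 \<le> t\<close> \<open>L \<ge> 0\<close> mult_nonneg_nonneg[of L t] by linarith
    have stay: "norm (x - xb) + M * (2 * t) \<le> R" using Mt d by (simp add: d_def)
    obtain z where z: "solution_on \<sigma> (switch t a b) x {0..2 * t} z" "z ` {0..2 * t} \<subseteq> cball xb R"
      by (rule short_solution_exists[OF L M ab \<open>L \<ge> 0\<close> less_imp_le[OF \<open>M > 0\<close>] _ Lt stay])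
        (use \<open>0 \<le> t\<close> in auto)
    have zS: "norm (?S (z s) *v a - ?S xb *v a) \<le> q / 8" "norm (?S (z s) *v b - ?S xb *v b) \<le> q / 8"
      if "s \<in> {0..2 * t}" for s
      using near z(2) that by blast+
    have "u (z (2 * t)) \<le> u x + t * (?g x \<bullet> (a + b)) + t\<^sup>2 / 2 * (- q) + 2 * (q / 8) * t\<^sup>2"
      using two_arc_estimate[OF u_d g_d z(1) \<open>0 \<le> t\<close> zS ab] by (simp only: q_def minus_minus)
    also have "\<dots> = u x + t * (?g x \<bullet> (a + b)) - q / 4 * t\<^sup>2"
      by (simp add: algebra_simps)
    also have "q / 4 * t\<^sup>2 = A1 * d + A2 * d"
      using \<open>q > 0\<close> by (simp add: t2 A_def field_simps)
    also have "t * (?g x \<bullet> (a + b)) \<le> A2 * d"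
    proof -
      have "?g x \<bullet> (a + b) \<le> norm (?g x) * norm (a + b)"
        by (rule norm_cauchy_schwarz)
      also have "\<dots> \<le> (A2 * d) * 2"
        using A2(3)[of x] d assms(3) ab norm_triangle_ineq[of a b] \<open>A2 > 0\<close>
        by (intro mult_mono) (auto simp: d_def)
      finally have "t * (?g x \<bullet> (a + b)) \<le> t * ((A2 * d) * 2)"
        using \<open>0 \<le> t\<close> by (rule mult_left_mono)
      also have "\<dots> \<le> 1/2 * ((A2 * d) * 2)"
        using \<open>t \<le> 1/2\<close> \<open>A2 > 0\<close> d by (intro mult_right_mono) auto
      finally show ?thesis by simp
    qed
    finally have "u (z (2 * t)) \<le> u xb"
      using A1(3)[of x] d by (simp add: d_def abs_le_iff)
    have unique: "y s = z s"
      if "solution_on \<sigma> (switch t a b) x I y" "solution_on \<sigma> (switch t a b) x J z" "s \<in> I" "s \<in> J"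
      for I J y z s
      by (rule solution_on_switch_unique[OF lip that])
    have "{0..2 * t} \<subseteq> I"
      by (rule trajectory_contains_solution[OF _ traj z(1)]) (rule unique)
    then have "2 * t \<in> I" using \<open>0 \<le> t\<close> by auto
    moreover have "y (2 * t) = z (2 * t)"
      using unique[OF _ z(1)] traj \<open>2 * t \<in> I\<close> \<open>0 \<le> t\<close> unfolding trajectory_def by auto
    ultimately show "2 * t \<in> I \<and> u (y (2 * t)) \<le> u xb"
      using \<open>u (z (2 * t)) \<le> u xb\<close> by simp
  qed
qed

section \<open>The quadratic form of \<open>K\<close>\<close>

lemma vec_join_inner: "vec_join a b \<bullet> vec_join c d = a \<bullet> c + b \<bullet> d"
  by (simp add: vec_join_def inner_vec_def UNIV_Plus_UNIV[symmetric] sum.Plus del: UNIV_Plus_UNIV)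

lemma block_mat_vec_join:
  "block_mat A B C D *v vec_join a b = vec_join (A *v a + B *v b) (C *v a + D *v b)"
  by (simp add: vec_eq_iff vec_join_def block_mat_def matrix_vector_mult_def
      UNIV_Plus_UNIV[symmetric] sum.Plus split: sum.split del: UNIV_Plus_UNIV)

text \<open>The two off-diagonal blocks of \<open>K\<close> are transposes of each other and contribute \<open>(S a) \<bullet> b\<close> each, while a
  matrix and its symmetric part have the same quadratic form.\<close>
lemma K_mat_quadratic_form:
  fixes u :: "real^'n \<Rightarrow> real" and \<sigma> :: "real^'n \<Rightarrow> real^'m^'n"
  shows "(K_mat u \<sigma> x *v vec_join a b) \<bullet> vec_join a b =
    (S_mat u \<sigma> x *v a) \<bullet> a + 2 * ((S_mat u \<sigma> x *v a) \<bullet> b) + (S_mat u \<sigma> x *v b) \<bullet> b"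
proof -
  define S where "S = S_mat u \<sigma> x"
  have tr: "(transpose S *v v) \<bullet> w = (S *v w) \<bullet> v" for v w
    by (metis transpose_matrix_vector dot_lmul_matrix inner_commute)
  have sym: "(sym_part S *v v) \<bullet> v = (S *v v) \<bullet> v" for v
    by (simp add: sym_part_def matrix_vector_mult_add_rdistrib scaleR_matrix_vector_assoc[symmetric]
        inner_add_left tr del: transpose_matrix_vector)
  show ?thesis
    by (simp add: K_mat_def Let_def S_def[symmetric] block_mat_vec_join vec_join_inner
        inner_add_left sym tr del: transpose_matrix_vector)
qed

lemma eigenvector_K_mat_form_negative:
  assumes "eigenvector_of (K_mat u \<sigma> x) l (vec_join a b)" "l < 0"
  shows "(S_mat u \<sigma> x *v a) \<bullet> a + 2 * ((S_mat u \<sigma> x *v a) \<bullet> b) + (S_mat u \<sigma> x *v b) \<bullet> b < 0"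
proof -
  have "(K_mat u \<sigma> x *v vec_join a b) \<bullet> vec_join a b = l * (vec_join a b \<bullet> vec_join a b)"
    using assms(1) by (simp add: eigenvector_of_def)
  moreover have "vec_join a b \<bullet> vec_join a b > 0"
    using assms(1) by (simp add: eigenvector_of_def)
  ultimately show ?thesis
    using \<open>l < 0\<close> by (metis K_mat_quadratic_form mult_neg_pos)
qed

lemma eigenvector_of_unit_controls:
  fixes K :: "real^('m::finite + 'm)^('m + 'm)"
  assumes "eigenvalue_of K l"
  obtains a b where "eigenvector_of K l (vec_join a b)" "norm a \<le> 1" "norm b \<le> 1"
proof -
  obtain v where v: "v \<noteq> 0" "K *v v = l *\<^sub>R v"
    using assms by (auto simp: eigenvalue_of_def eigenvector_of_def)
  define w where "w = (1 / norm v) *\<^sub>R v"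
  define a b where "a = (\<chi> i. w $ Inl i)" and "b = (\<chi> i. w $ Inr i)"
  have w: "vec_join a b = w"
    by (simp add: vec_join_def a_def b_def vec_eq_iff split: sum.split)
  have "norm w = 1" using v by (simp add: w_def)
  then have "a \<bullet> a + b \<bullet> b = 1"
    using vec_join_inner[of a b a b] by (simp add: w dot_square_norm)
  then have "a \<bullet> a \<le> 1" "b \<bullet> b \<le> 1"
    using inner_ge_zero[of a] inner_ge_zero[of b] by linarith+
  then have "norm a \<le> 1" "norm b \<le> 1"
    by (simp_all add: norm_eq_sqrt_inner)
  moreover have "eigenvector_of K l w"
    using v by (simp add: eigenvector_of_def w_def matrix_vector_mult_scaleR scaleR_left_commute)
  ultimately show ?thesis using that w by metis
qed

section \<open>Attainability and the minimum time estimate\<close>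

theorem theorem4p5:
  fixes \<sigma> :: "real^'n \<Rightarrow> real^'m^'n" and u :: "real^'n \<Rightarrow> real" and xb :: "real^'n"
  assumes "class_C 2 \<sigma>" and "class_C 3 u"
    and "grad u xb \<noteq> 0" and "grad_along u \<sigma> xb = 0"
    and "\<exists>l<0. eigenvalue_of (K_mat u \<sigma> xb) l"
  shows "STLA \<sigma> {x. u x \<le> u xb} xb \<and>
         (\<exists>C>0. \<exists>r>0. \<forall>x. norm (x - xb) \<le> r \<longrightarrow>
           min_time \<sigma> {x. u x \<le> u xb} x \<le> ereal (C * norm (x - xb) powr (1/2))) \<and>
         (\<forall>l a\<^sub>1 a\<^sub>2. minimal_eigenvalue (K_mat u \<sigma> xb) l \<and>
           eigenvector_of (K_mat u \<sigma> xb) l (vec_join a\<^sub>1 a\<^sub>2) \<and> norm a\<^sub>1 \<le> 1 \<and> norm a\<^sub>2 \<le> 1 \<longrightarrow>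
           (\<forall>\<^sub>F x\<^sub>0 in nhds xb. \<exists>t>0.
              (\<exists>I y. trajectory \<sigma> (\<lambda>s. if s < t then a\<^sub>1 else a\<^sub>2) x\<^sub>0 I y) \<and>
              (\<forall>I y. trajectory \<sigma> (\<lambda>s. if s < t then a\<^sub>1 else a\<^sub>2) x\<^sub>0 I y \<longrightarrow>
                 (\<exists>s\<in>I. s \<le> 2 * t \<and> u (y s) \<le> u xb))))"
proof -
  let ?T = "{x. u x \<le> u xb}" and ?K = "K_mat u \<sigma> xb"
  have \<sigma>: "class_C 1 \<sigma>" and u: "class_C 2 u"
    by (rule class_C_mono[OF assms(1)] class_C_mono[OF assms(2)], simp)+
  have "lipschitz_on_balls \<sigma>" using \<sigma> by (simp add: class_C_1_lipschitz)
  then have ex: "\<exists>I y. trajectory \<sigma> (switch t a b) x I y" for t a b x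
    by (intro maximal_trajectory_exists) (rule solution_on_switch_unique)
  note near = target_reached_near[OF \<sigma> u assms(4)]
  obtain l a b where l: "l < 0" "eigenvector_of ?K l (vec_join a b)" and ab: "norm a \<le> 1" "norm b \<le> 1"
    using assms(5) eigenvector_of_unit_controls by metis
  obtain C r where "C > 0" "r > 0"
    and reach: "\<And>x t I y. \<lbrakk>norm (x - xb) \<le> r; t = C * sqrt (norm (x - xb));
        trajectory \<sigma> (switch t a b) x I y\<rbrakk> \<Longrightarrow> 2 * t \<in> I \<and> u (y (2 * t)) \<le> u xb"
    using near[OF ab eigenvector_K_mat_form_negative[OF l(2,1)]] by blast
  have hit: "\<exists>c\<in>controls. 2 * C * sqrt (norm (x - xb)) \<in> hitting_times \<sigma> ?T x c"
    if x: "norm (x - xb) \<le> r" for x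
  proof
    let ?t = "C * sqrt (norm (x - xb))"
    show "switch ?t a b \<in> controls" by (rule switch_in_controls[OF ab])
    obtain I y where "trajectory \<sigma> (switch ?t a b) x I y" using ex by blast
    with reach[OF x refl this] show "2 * C * sqrt (norm (x - xb)) \<in> hitting_times \<sigma> ?T x (switch ?t a b)"
      unfolding hitting_times_def mult.assoc by blast
  qed
  have "STLA \<sigma> ?T xb"
    unfolding STLA_def
  proof (intro allI impI)
    fix t :: real assume "t > 0"
    define \<rho> where "\<rho> = min r ((t / (2 * C))\<^sup>2)"
    have "\<rho> > 0" using \<open>r > 0\<close> \<open>t > 0\<close> \<open>C > 0\<close> by (simp add: \<rho>_def)
    moreover have "\<exists>c\<in>controls. \<exists>s\<in>hitting_times \<sigma> ?T x c. s < t" if "x \<in> ball xb \<rho>" for x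
    proof -
      have x: "norm (x - xb) \<le> r" "norm (x - xb) < (t / (2 * C))\<^sup>2"
        using that by (auto simp: \<rho>_def dist_norm norm_minus_commute)
      then have "sqrt (norm (x - xb)) < t / (2 * C)"
        using \<open>t > 0\<close> \<open>C > 0\<close> by (intro real_less_lsqrt) auto
      then have "2 * C * sqrt (norm (x - xb)) < t"
        using \<open>C > 0\<close> by (simp add: field_simps)
      then show ?thesis using hit[OF x(1)] by blast
    qed
    ultimately show "xb \<in> interior {x. \<exists>c\<in>controls. \<exists>s\<in>hitting_times \<sigma> ?T x c. s < t}"
      unfolding mem_interior by blast
  qed
  moreover have "min_time \<sigma> ?T x \<le> ereal (2 * C * norm (x - xb) powr (1/2))"
    if x: "norm (x - xb) \<le> r" for x
  proof -
    obtain c where c: "c \<in> controls" "2 * C * sqrt (norm (x - xb)) \<in> hitting_times \<sigma> ?T x c"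
      using hit[OF x] by blast
    then have "hitting_time \<sigma> ?T x c \<le> ereal (2 * C * sqrt (norm (x - xb)))"
      unfolding hitting_time_def by (intro Inf_lower) blast
    then have "min_time \<sigma> ?T x \<le> ereal (2 * C * sqrt (norm (x - xb)))"
      unfolding min_time_def using c(1) by (rule INF_lower2[rotated])
    then show ?thesis by (simp add: powr_half_sqrt)
  qed
  then have "\<exists>C>0. \<exists>r>0. \<forall>x. norm (x - xb) \<le> r \<longrightarrow>
      min_time \<sigma> ?T x \<le> ereal (C * norm (x - xb) powr (1/2))"
    using \<open>C > 0\<close> \<open>r > 0\<close> by (intro exI[of _ "2 * C"] exI[of _ r] conjI) auto
  moreover have "\<forall>\<^sub>F x\<^sub>0 in nhds xb. \<exists>t>0. (\<exists>I y. trajectory \<sigma> (switch t a\<^sub>1 a\<^sub>2) x\<^sub>0 I y) \<and>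
      (\<forall>I y. trajectory \<sigma> (switch t a\<^sub>1 a\<^sub>2) x\<^sub>0 I y \<longrightarrow> (\<exists>s\<in>I. s \<le> 2 * t \<and> u (y s) \<le> u xb))"
    if min: "minimal_eigenvalue ?K k" and k: "eigenvector_of ?K k (vec_join a\<^sub>1 a\<^sub>2)"
      and a: "norm a\<^sub>1 \<le> 1" "norm a\<^sub>2 \<le> 1" for k a\<^sub>1 a\<^sub>2
  proof -
    have "k < 0" using min assms(5) by (force simp: minimal_eigenvalue_def)
    obtain C r where "C > 0" "r > 0"
      and reach: "\<And>x t I y. \<lbrakk>norm (x - xb) \<le> r; t = C * sqrt (norm (x - xb));
          trajectory \<sigma> (switch t a\<^sub>1 a\<^sub>2) x I y\<rbrakk> \<Longrightarrow> 2 * t \<in> I \<and> u (y (2 * t)) \<le> u xb"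
      using near[OF a eigenvector_K_mat_form_negative[OF k \<open>k < 0\<close>]] by blast
    have "\<exists>t>0. \<forall>I y. trajectory \<sigma> (switch t a\<^sub>1 a\<^sub>2) x I y \<longrightarrow> (\<exists>s\<in>I. s \<le> 2 * t \<and> u (y s) \<le> u xb)"
      if x: "dist x xb < r" for x
    proof (cases "x = xb")
      case True
      \<comment> \<open>Here \<open>C * sqrt 0\<close> is not positive, but the target contains the starting point, so any \<open>t\<close> will do.\<close>
      show ?thesis
      proof (intro exI[of _ 1] conjI allI impI bexI[of _ 0])
        fix I y assume "trajectory \<sigma> (switch 1 a\<^sub>1 a\<^sub>2) x I y"
        then show "0 \<in> I" "u (y 0) \<le> u xb"
          using True by (auto simp: trajectory_def solution_on_def)
      qed auto
    next
      case False
      then have "C * sqrt (norm (x - xb)) > 0" using \<open>C > 0\<close> by simp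
      then show ?thesis
        using reach[OF _ refl] x by (metis dist_norm less_imp_le order_refl)
    qed
    then show ?thesis
      using ex \<open>r > 0\<close> unfolding eventually_nhds_metric by blast
  qed
  ultimately show ?thesis by blast
qed

end
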